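(* Let $n\ge 2$ and let $\tau\ge 0$ be such that $\mathcal C_n(\tau)\neq\emptyset$. For every $\omega\in\mathcal{C}_n(\tau)$, $$K_n(\omega)\geq \frac{1}{\sqrt2}+\left(\sqrt{1-\frac{\tau^2}{4}}-\tau\right)\frac{\tau}{2\sqrt2}.$$ Moreover, when $n\geq4$, the estimate is optimal for $0\leq \tau\leq\sqrt{2-\sqrt2}$ (i.e. for each such $\tau$ equality is attained at some $\omega\in\mathcal C_n(\tau)$). In that range, for $\omega\in\mathcal C_n(\tau)$, equality holds if and only if $$\omega=\omega_\tau:=(r,r,s,s,0,\ldots,0),\qquad r=\frac{1-\tau^2/2}{\sqrt2},\qquad s=\frac{\tau}{\sqrt2}\sqrt{1-\frac{\tau^2}{4}}.$$
   Context: Let $\epsilon_1,\dots,\epsilon_n$ be independent Rademacher random variables (uniform on $\{-1,1\}$). For $\omega\in\mathbb R^n$ put $K_n(\omega)=\mathbb E\left|\sum_{i=1}^n\omega_i\epsilon_i\right|$. A vector $\omega\in\mathbb R^n$ is called a proper unit vector if $\|\omega\|_2=1$ and $\omega_1\ge\omega_2\ge\cdots\ge\omega_n\ge0$. Let $\omega^*=(1/\sqrt2,1/\sqrt2,0,\dots,0)\in\mathbb R^n$ and let $\mathcal C_n(\tau)$ be the set of proper unit vectors $\omega\in\mathbb R^n$ with $\|\omega-\omega^*\|_2=\tau$. *)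

theory Defs
  imports "HOL-Probability.Probability"
begin

text \<open>
  A vector of \<open>\<real>\<^sup>n\<close> is a function on \<open>nat\<close> with coordinates indexed by \<open>1, \<dots>, n\<close> and value 0
  outside \<open>{1..n}\<close>, so that equality of such functions is equality of vectors.
\<close>

definition real_space :: "nat \<Rightarrow> (nat \<Rightarrow> real) set" where
  "real_space n = {\<omega>. \<forall>i. i \<notin> {1..n} \<longrightarrow> \<omega> i = 0}"

definition proper_unit_vectors :: "nat \<Rightarrow> (nat \<Rightarrow> real) set" where
  "proper_unit_vectors n =
     {\<omega> \<in> real_space n. L2_set \<omega> {1..n} = 1 \<and> antimono_on {1..n} \<omega> \<and> (\<forall>i\<in>{1..n}. 0 \<le> \<omega> i)}"

definition omega_star :: "nat \<Rightarrow> real" where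
  "omega_star i = (if i \<in> {1, 2} then 1 / sqrt 2 else 0)"

definition C :: "nat \<Rightarrow> real \<Rightarrow> (nat \<Rightarrow> real) set" where
  "C n \<tau> = {\<omega> \<in> proper_unit_vectors n. L2_set (\<lambda>i. \<omega> i - omega_star i) {1..n} = \<tau>}"

definition omega_tau :: "real \<Rightarrow> nat \<Rightarrow> real" where
  "omega_tau \<tau> i =
     (if i \<in> {1, 2} then (1 - \<tau>\<^sup>2 / 2) / sqrt 2
      else if i \<in> {3, 4} then \<tau> / sqrt 2 * sqrt (1 - \<tau>\<^sup>2 / 4)
      else 0)"

definition rademacher :: "'a measure \<Rightarrow> ('a \<Rightarrow> real) \<Rightarrow> bool" where
  "rademacher M X \<longleftrightarrow>
     X \<in> borel_measurable M \<and>
     distr M borel X = distr (measure_pmf (pmf_of_set {-1, 1})) borel (\<lambda>x. x)"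

definition K :: "'a measure \<Rightarrow> (nat \<Rightarrow> 'a \<Rightarrow> real) \<Rightarrow> nat \<Rightarrow> (nat \<Rightarrow> real) \<Rightarrow> real" where
  "K M \<epsilon> n \<omega> = (LINT x|M. \<bar>\<Sum>i=1..n. \<omega> i * \<epsilon> i x\<bar>)"

end

theory Submission
  imports Defs
begin

text \<open>
  Put \<open>r = (\<omega> 1 + \<omega> 2) / 2\<close> and \<open>d = \<omega> 1 - \<omega> 2\<close>, and let \<open>T\<close> be the Rademacher sum of the tail
  \<open>\<omega> 3, \<dots>, \<omega> n\<close>. For unit vectors the distance \<open>\<tau>\<close> to \<open>omega_star\<close> is a function of \<open>r\<close> alone; with
  \<open>2 * r\<^sup>2 + 2 * s\<^sup>2 = 1\<close> the asserted bound reads \<open>r + s / 2\<close>. Conditioning on the first two signs,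
  the mean is half of \<open>E \<bar>2 * r + T\<bar> + E \<bar>d + T\<bar>\<close>. The first term is at least \<open>2 * r\<close> by Jensen's
  inequality. The second is the mean modulus of the Rademacher sum with weights \<open>d, \<omega> 3, \<dots>, \<omega> n\<close>, whose squared
  norm is \<open>2 * s\<^sup>2 + d\<^sup>2 / 2\<close>, so Khintchine's inequality with Szarek's constant \<open>1 / sqrt 2\<close>
  bounds it below by \<open>s\<close>. This is \<open>extremal_bound\<close>.

  Equality forces \<open>d = 0\<close> and equality in Khintchine's inequality for the tail, which by
  \<open>khintchine_equality\<close> means that the tail is zero or has exactly two nonzero weights, which are equal. Being
  decreasing, \<open>\<omega>\<close> is then \<open>(r, r, s, s, 0, \<dots>)\<close>. For \<open>s \<le> r\<close> this vector does attain the bound, by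
  \<open>omega_tau_extremal\<close>.

  Khintchine's inequality is proved by the method of Latala and Oleszkiewicz. For \<open>f = \<bar>S\<bar>\<close>, where \<open>S\<close> is a
  signed sum of \<open>n\<close> weights, the sum of \<open>f\<close> over the \<open>n\<close> neighbours of a vertex of the cube is at
  least \<open>(n - 2) * f\<close> by the triangle inequality. On the other hand \<open>f\<close> is even, so in its expansion into
  characters the degrees other than 0 are at least 2, and \<open>E (f * flip_sum f)\<close> is at most
  \<open>(n - 4) * E f\<^sup>2 + 4 * (E f)\<^sup>2\<close>. Together these say \<open>E f\<^sup>2 \<le> 2 * (E f)\<^sup>2\<close>.
  In the case of equality the triangle inequality is an equality at each vertex where \<open>S\<close> does not vanish. This forces
  the nonzero weights to be equal and even in number, and a recursion in their number shows that four or more of them give strict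
  inequality.
\<close>

section \<open>Means over the discrete cube\<close>

text \<open>
  A sign vector on the index set \<open>I\<close> is encoded by the set \<open>P \<subseteq> I\<close> of coordinates at which
  it equals \<open>-1\<close>. Subsets lend themselves to induction on \<open>I\<close>, and minus the vector is \<open>I - P\<close>.
\<close>

definition cube_mean :: "'i set \<Rightarrow> ('i set \<Rightarrow> real) \<Rightarrow> real" where
  "cube_mean I f = (\<Sum>P\<in>Pow I. f P) / 2 ^ card I"

definition coord_sign :: "'i set \<Rightarrow> 'i \<Rightarrow> real" where
  "coord_sign P i = (if i \<in> P then -1 else 1)"

definition signed_sum :: "'i set \<Rightarrow> ('i \<Rightarrow> real) \<Rightarrow> 'i set \<Rightarrow> real" where
  "signed_sum I a P = (\<Sum>i\<in>I. a i * coord_sign P i)"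

definition flip :: "'i \<Rightarrow> 'i set \<Rightarrow> 'i set" where
  "flip i P = (if i \<in> P then P - {i} else insert i P)"

text \<open>
  Up to the factor \<open>card I\<close> this is one step of the simple random walk on the cube. Its eigenvalue on the
  characters of degree \<open>k\<close> is \<open>card I - 2 * k\<close>, which is where the constants below come from.
\<close>

definition flip_sum :: "'i set \<Rightarrow> ('i set \<Rightarrow> real) \<Rightarrow> 'i set \<Rightarrow> real" where
  "flip_sum I f P = (\<Sum>i\<in>I. f (flip i P))"

text \<open>
  The offset \<open>c\<close> makes room for coordinates that have been split off, so that \<open>mean_abs\<close> satisfies
  a closed recursion in the index set.
\<close>

definition mean_abs :: "'i set \<Rightarrow> ('i \<Rightarrow> real) \<Rightarrow> real \<Rightarrow> real" where
  "mean_abs I a c = cube_mean I (\<lambda>P. \<bar>c + signed_sum I a P\<bar>)"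

lemma cube_mean_empty [simp]: "cube_mean {} f = f {}"
  by (simp add: cube_mean_def)

lemma cube_mean_insert:
  assumes "finite I" "i \<notin> I"
  shows "cube_mean (insert i I) f = (cube_mean I f + cube_mean I (\<lambda>P. f (insert i P))) / 2"
proof -
  have inj: "inj_on (insert i) (Pow I)" using assms by (auto simp: inj_on_def)
  have "(\<Sum>P\<in>Pow (insert i I). f P) = (\<Sum>P\<in>Pow I. f P) + (\<Sum>P\<in>insert i ` Pow I. f P)"
    unfolding Pow_insert by (rule sum.union_disjoint) (use assms in auto)
  also have "(\<Sum>P\<in>insert i ` Pow I. f P) = (\<Sum>P\<in>Pow I. f (insert i P))"
    by (simp add: sum.reindex[OF inj])
  finally show ?thesis using assms by (simp add: cube_mean_def field_simps)
qed

lemma cube_mean_cong: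
  assumes "\<And>P. P \<subseteq> I \<Longrightarrow> f P = g P"
  shows "cube_mean I f = cube_mean I g"
  using assms by (simp add: cube_mean_def)

lemma cube_mean_mono:
  assumes "\<And>P. P \<subseteq> I \<Longrightarrow> f P \<le> g P"
  shows "cube_mean I f \<le> cube_mean I g"
  using assms by (auto simp: cube_mean_def intro!: divide_right_mono sum_mono)

lemma cube_mean_add: "cube_mean I (\<lambda>P. f P + g P) = cube_mean I f + cube_mean I g"
  by (simp add: cube_mean_def sum.distrib add_divide_distrib)

lemma cube_mean_diff: "cube_mean I (\<lambda>P. f P - g P) = cube_mean I f - cube_mean I g"
  by (simp add: cube_mean_def sum_subtractf diff_divide_distrib)

lemma cube_mean_cmult: "cube_mean I (\<lambda>P. c * f P) = c * cube_mean I f"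
  by (simp add: cube_mean_def sum_distrib_left)

lemma cube_mean_sum: "cube_mean I (\<lambda>P. \<Sum>j\<in>J. f j P) = (\<Sum>j\<in>J. cube_mean I (f j))"
  by (simp add: cube_mean_def sum_divide_distrib sum.swap[of _ J])

lemma cube_mean_eq_0D:
  assumes "finite I" "cube_mean I f = 0" "\<And>P. P \<subseteq> I \<Longrightarrow> f P \<ge> 0" "P \<subseteq> I"
  shows "f P = 0"
proof -
  have "(\<Sum>P\<in>Pow I. f P) = 0" using assms(2) by (simp add: cube_mean_def)
  then show ?thesis using assms by (subst (asm) sum_nonneg_eq_0_iff) auto
qed

lemma cube_mean_compl: "cube_mean I (\<lambda>P. f (I - P)) = cube_mean I f"
  unfolding cube_mean_def
  by (intro arg_cong2[where f = "(/)"] refl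
      sum.reindex_bij_witness[where i = "\<lambda>P. I - P" and j = "\<lambda>P. I - P"]) (auto simp: double_diff)

lemma cube_mean_flip:
  assumes "i \<in> I"
  shows "cube_mean I (\<lambda>P. f (flip i P)) = cube_mean I f"
  unfolding cube_mean_def
  by (intro arg_cong2[where f = "(/)"] refl
      sum.reindex_bij_witness[where i = "flip i" and j = "flip i"])
     (use assms in \<open>auto simp: flip_def split: if_splits\<close>)

lemma flip_sum_insert:
  assumes "finite I" "i \<notin> I" "P \<subseteq> I"
  shows "flip_sum (insert i I) f P = f (insert i P) + flip_sum I f P"
    and "flip_sum (insert i I) f (insert i P) = f P + flip_sum I (\<lambda>P. f (insert i P)) P"
proof -
  have iP: "i \<notin> P" using assms by auto
  show "flip_sum (insert i I) f P = f (insert i P) + flip_sum I f P"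
    using assms iP by (simp add: flip_sum_def flip_def)
  have "flip j (insert i P) = insert i (flip j P)" if "j \<in> I" for j
    using that assms by (auto simp: flip_def)
  then show "flip_sum (insert i I) f (insert i P) = f P + flip_sum I (\<lambda>P. f (insert i P)) P"
    using assms iP by (simp add: flip_sum_def) (simp add: flip_def)
qed

section \<open>Spectral gaps of the cube\<close>

text \<open>
  Write \<open>f = g + x\<^sub>i h\<close> with \<open>g, h\<close> independent of the \<open>i\<close>-th sign \<open>x\<^sub>i\<close>. Flipping \<open>i\<close> fixes \<open>g\<close>
  and negates \<open>x\<^sub>i h\<close>; the other flips act on \<open>g\<close> and \<open>h\<close> separately, and the mixed terms average
  to zero.
\<close>

lemma flip_energy_insert:
  fixes f :: "'i set \<Rightarrow> real"
  assumes "finite I" "i \<notin> I"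
  defines "g \<equiv> \<lambda>P. (f P + f (insert i P)) / 2"
    and "h \<equiv> \<lambda>P. (f P - f (insert i P)) / 2"
  shows "cube_mean (insert i I) (\<lambda>P. f P * flip_sum (insert i I) f P) =
           cube_mean I (\<lambda>P. (g P)\<^sup>2) - cube_mean I (\<lambda>P. (h P)\<^sup>2)
           + cube_mean I (\<lambda>P. g P * flip_sum I g P) + cube_mean I (\<lambda>P. h P * flip_sum I h P)"
proof -
  let ?f = "\<lambda>P. f (insert i P)"
  have gs: "flip_sum I g P = (flip_sum I f P + flip_sum I ?f P) / 2"
    and hs: "flip_sum I h P = (flip_sum I f P - flip_sum I ?f P) / 2" for P
    by (simp_all add: flip_sum_def g_def h_def sum.distrib sum_subtractf
        flip: sum_divide_distrib)
  have "cube_mean (insert i I) (\<lambda>P. f P * flip_sum (insert i I) f P) =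
      (cube_mean I (\<lambda>P. f P * (?f P + flip_sum I f P))
       + cube_mean I (\<lambda>P. ?f P * (f P + flip_sum I ?f P))) / 2"
    unfolding cube_mean_insert[OF assms(1,2)]
    by (intro arg_cong2[where f = "(/)"] arg_cong2[where f = "(+)"] cube_mean_cong refl)
       (simp_all add: flip_sum_insert assms(1,2))
  also have "\<dots> = cube_mean I (\<lambda>P. (1 / 2) * (f P * (?f P + flip_sum I f P) + ?f P * (f P + flip_sum I ?f P)))"
    unfolding cube_mean_cmult cube_mean_add by simp
  also have "\<dots> = cube_mean I (\<lambda>P. (g P)\<^sup>2 - (h P)\<^sup>2 + g P * flip_sum I g P + h P * flip_sum I h P)"
    unfolding gs hs
    by (rule cube_mean_cong) (simp add: g_def h_def power2_eq_square field_simps)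
  finally show ?thesis by (simp add: cube_mean_add cube_mean_diff)
qed

lemma cube_mean_square_insert:
  assumes "finite I" "i \<notin> I"
  shows "cube_mean (insert i I) (\<lambda>P. (f P)\<^sup>2) =
           cube_mean I (\<lambda>P. ((f P + f (insert i P)) / 2)\<^sup>2)
           + cube_mean I (\<lambda>P. ((f P - f (insert i P)) / 2)\<^sup>2)"
proof -
  have "cube_mean (insert i I) (\<lambda>P. (f P)\<^sup>2) =
      cube_mean I (\<lambda>P. (1 / 2) * ((f P)\<^sup>2 + (f (insert i P))\<^sup>2))"
    unfolding cube_mean_insert[OF assms] cube_mean_cmult cube_mean_add by simp
  also have "\<dots> = cube_mean I (\<lambda>P. ((f P + f (insert i P)) / 2)\<^sup>2 + ((f P - f (insert i P)) / 2)\<^sup>2)"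
    by (rule cube_mean_cong) (simp add: power2_eq_square field_simps)
  finally show ?thesis by (simp add: cube_mean_add)
qed

lemma cube_mean_average:
  assumes "finite I" "i \<notin> I"
  shows "cube_mean I (\<lambda>P. (f P + f (insert i P)) / 2) = cube_mean (insert i I) f"
  using cube_mean_cmult[of I "1/2" "\<lambda>P. f P + f (insert i P)"]
  by (simp add: cube_mean_insert[OF assms] cube_mean_add)

text \<open>
  The spectral gap of the cube: only constants have eigenvalue \<open>card I\<close>, all other characters have at most
  \<open>card I - 2\<close>. The induction needs no Fourier expansion. In the decomposition \<open>f = g + x\<^sub>i h\<close> it uses
  the bound for \<open>g\<close> and for \<open>h\<close>, and the slack for \<open>h\<close> is twice its variance.
\<close>

lemma cube_poincare:
  assumes "finite I"
  shows "cube_mean I (\<lambda>P. f P * flip_sum I f P)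
           \<le> (real (card I) - 2) * cube_mean I (\<lambda>P. (f P)\<^sup>2) + 2 * (cube_mean I f)\<^sup>2"
  using assms
proof (induction I arbitrary: f rule: finite_induct)
  case empty
  show ?case by (simp add: flip_sum_def)
next
  case (insert i I)
  define g where "g = (\<lambda>P. (f P + f (insert i P)) / 2)"
  define h where "h = (\<lambda>P. (f P - f (insert i P)) / 2)"
  have variance: "(cube_mean I h)\<^sup>2 \<le> cube_mean I (\<lambda>P. (h P)\<^sup>2)"
  proof -
    let ?m = "cube_mean I h"
    have "0 = cube_mean I (\<lambda>P. 0)" by (simp add: cube_mean_def)
    also have "\<dots> \<le> cube_mean I (\<lambda>P. (h P - ?m)\<^sup>2)" by (rule cube_mean_mono) simp
    also have "\<dots> = cube_mean I (\<lambda>P. (h P)\<^sup>2 - (2 * ?m) * h P + ?m\<^sup>2 * 1)"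
      by (rule cube_mean_cong) (simp add: power2_diff)
    also have "\<dots> = cube_mean I (\<lambda>P. (h P)\<^sup>2) - 2 * ?m * ?m + ?m\<^sup>2 * cube_mean I (\<lambda>P. 1)"
      by (simp only: cube_mean_add cube_mean_diff cube_mean_cmult)
    also have "cube_mean I (\<lambda>P. 1) = 1"
      using insert.hyps by (simp add: cube_mean_def card_Pow)
    finally show ?thesis by (simp add: power2_eq_square)
  qed
  have split: "cube_mean (insert i I) (\<lambda>P. f P * flip_sum (insert i I) f P) =
           cube_mean I (\<lambda>P. (g P)\<^sup>2) - cube_mean I (\<lambda>P. (h P)\<^sup>2)
           + cube_mean I (\<lambda>P. g P * flip_sum I g P) + cube_mean I (\<lambda>P. h P * flip_sum I h P)"
    unfolding g_def h_def by (rule flip_energy_insert[OF insert.hyps])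
  have sq: "cube_mean (insert i I) (\<lambda>P. (f P)\<^sup>2) = cube_mean I (\<lambda>P. (g P)\<^sup>2) + cube_mean I (\<lambda>P. (h P)\<^sup>2)"
    unfolding g_def h_def by (rule cube_mean_square_insert[OF insert.hyps])
  have avg: "cube_mean (insert i I) f = cube_mean I g" 
    unfolding g_def by (rule cube_mean_average[OF insert.hyps, symmetric])
  show ?case
    unfolding split sq avg card_insert_disjoint[OF insert.hyps]
    using insert.IH[of g] insert.IH[of h] variance by (simp add: algebra_simps)
qed

text \<open>
  Once the characters of degree one are accounted for separately, the next eigenvalue is \<open>card I - 4\<close>.
  In the induction, \<open>x\<^sub>i h\<close> shifts degrees by one, so that the plain gap \<open>cube_poincare\<close> is
  what is needed for \<open>h\<close>, while the mean of \<open>h\<close> is the new degree one coefficient.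
\<close>

lemma cube_poincare_level_two:
  assumes "finite I"
  shows "cube_mean I (\<lambda>P. f P * flip_sum I f P)
           \<le> (real (card I) - 4) * cube_mean I (\<lambda>P. (f P)\<^sup>2) + 4 * (cube_mean I f)\<^sup>2
             + 2 * (\<Sum>j\<in>I. (cube_mean I (\<lambda>P. coord_sign P j * f P))\<^sup>2)"
  using assms
proof (induction I arbitrary: f rule: finite_induct)
  case empty
  show ?case by (simp add: flip_sum_def)
next
  case (insert i I)
  define g where "g = (\<lambda>P. (f P + f (insert i P)) / 2)"
  define h where "h = (\<lambda>P. (f P - f (insert i P)) / 2)"
  have split: "cube_mean (insert i I) (\<lambda>P. f P * flip_sum (insert i I) f P) =
           cube_mean I (\<lambda>P. (g P)\<^sup>2) - cube_mean I (\<lambda>P. (h P)\<^sup>2)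
           + cube_mean I (\<lambda>P. g P * flip_sum I g P) + cube_mean I (\<lambda>P. h P * flip_sum I h P)"
    unfolding g_def h_def by (rule flip_energy_insert[OF insert.hyps])
  have sq: "cube_mean (insert i I) (\<lambda>P. (f P)\<^sup>2) = cube_mean I (\<lambda>P. (g P)\<^sup>2) + cube_mean I (\<lambda>P. (h P)\<^sup>2)"
    unfolding g_def h_def by (rule cube_mean_square_insert[OF insert.hyps])
  have avg: "cube_mean (insert i I) f = cube_mean I g"
    unfolding g_def by (rule cube_mean_average[OF insert.hyps, symmetric])
  have coeff: "cube_mean (insert i I) (\<lambda>P. coord_sign P j * f P) = cube_mean I (\<lambda>P. coord_sign P j * g P)"
    if "j \<in> I" for j
    unfolding cube_mean_average[OF insert.hyps, symmetric]
    using that insert.hyps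
    by (intro cube_mean_cong) (auto simp: coord_sign_def g_def field_simps)
  have coeff_new: "cube_mean (insert i I) (\<lambda>P. coord_sign P i * f P) = cube_mean I h"
    unfolding cube_mean_average[OF insert.hyps, symmetric]
    using insert.hyps
    by (intro cube_mean_cong) (auto simp: coord_sign_def h_def field_simps)
  have weights: "(\<Sum>j\<in>insert i I. (cube_mean (insert i I) (\<lambda>P. coord_sign P j * f P))\<^sup>2)
      = (cube_mean I h)\<^sup>2 + (\<Sum>j\<in>I. (cube_mean I (\<lambda>P. coord_sign P j * g P))\<^sup>2)"
    using insert.hyps by (simp add: coeff coeff_new)
  show ?case
    unfolding split sq weights avg
      card_insert_disjoint[OF insert.hyps]
    using insert.IH[of g] cube_poincare[OF insert.hyps(1), of h]
    by (simp add: algebra_simps)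
qed

section \<open>Signed sums\<close>

lemma coord_sign_flip: "coord_sign (flip i P) j = (if j = i then - coord_sign P j else coord_sign P j)"
  by (cases "i \<in> P") (simp_all add: coord_sign_def flip_def)

lemma signed_sum_flip:
  assumes "finite I" "i \<in> I"
  shows "signed_sum I a (flip i P) = signed_sum I a P - 2 * a i * coord_sign P i"
  using assms by (simp add: signed_sum_def sum.remove[of I i] coord_sign_flip)

lemma flip_sum_signed_sum:
  assumes "finite I"
  shows "flip_sum I (signed_sum I a) P = (real (card I) - 2) * signed_sum I a P"
proof -
  have "flip_sum I (signed_sum I a) P = (\<Sum>i\<in>I. signed_sum I a P - 2 * (a i * coord_sign P i))"
    unfolding flip_sum_def using assms by (intro sum.cong refl) (simp add: signed_sum_flip)
  also have "\<dots> = real (card I) * signed_sum I a P - 2 * signed_sum I a P"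
    by (simp add: sum_subtractf signed_sum_def flip: sum_distrib_left)
  finally show ?thesis by (simp add: algebra_simps)
qed

text \<open>
  The signed sum \<open>S\<close> has degree one, so \<open>\<Sum>\<^sub>i S (flip i P) = (card I - 2) * S P\<close>; the triangle
  inequality does the rest. Its equality case is what drives the classification of extremal weights.
\<close>

lemma flip_sum_abs_ge:
  assumes "finite I"
  shows "flip_sum I (\<lambda>P. \<bar>signed_sum I a P\<bar>) P \<ge> (real (card I) - 2) * \<bar>signed_sum I a P\<bar>"
proof -
  have "(real (card I) - 2) * \<bar>signed_sum I a P\<bar> \<le> \<bar>flip_sum I (signed_sum I a) P\<bar>"
    unfolding flip_sum_signed_sum[OF assms] abs_mult by (intro mult_right_mono) auto
  also have "\<dots> \<le> flip_sum I (\<lambda>P. \<bar>signed_sum I a P\<bar>) P"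
    unfolding flip_sum_def by (rule sum_abs)
  finally show ?thesis .
qed

lemma signed_sum_compl:
  assumes "P \<subseteq> I"
  shows "signed_sum I a (I - P) = - signed_sum I a P"
proof -
  have "a i * coord_sign (I - P) i = - (a i * coord_sign P i)" if "i \<in> I" for i
    using that by (simp add: coord_sign_def)
  then show ?thesis by (simp add: signed_sum_def sum_negf)
qed

lemma signed_sum_insert:
  assumes "finite I" "i \<notin> I" "P \<subseteq> I"
  shows "signed_sum (insert i I) a P = a i + signed_sum I a P"
    and "signed_sum (insert i I) a (insert i P) = signed_sum I a P - a i"
proof -
  have iP: "i \<notin> P" using assms by auto
  show "signed_sum (insert i I) a P = a i + signed_sum I a P"
    using assms(1,2) iP by (simp add: signed_sum_def coord_sign_def)
  have "(\<Sum>j\<in>I. a j * coord_sign (insert i P) j) = (\<Sum>j\<in>I. a j * coord_sign P j)"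
    by (intro sum.cong refl) (use assms(2) in \<open>auto simp: coord_sign_def\<close>)
  moreover have "coord_sign (insert i P) i = - 1" by (simp add: coord_sign_def)
  ultimately show "signed_sum (insert i I) a (insert i P) = signed_sum I a P - a i"
    using assms(1,2) by (simp add: signed_sum_def)
qed

lemma mean_abs_insert:
  assumes "finite I" "i \<notin> I"
  shows "mean_abs (insert i I) a c = (mean_abs I a (c + a i) + mean_abs I a (c - a i)) / 2"
  unfolding mean_abs_def cube_mean_insert[OF assms]
  by (intro arg_cong2[where f = "(/)"] arg_cong2[where f = "(+)"] cube_mean_cong refl)
     (simp_all add: signed_sum_insert assms algebra_simps)

lemma mean_abs_empty [simp]: "mean_abs {} a c = \<bar>c\<bar>"
  by (simp add: mean_abs_def signed_sum_def)

lemma mean_abs_minus: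
  assumes "finite I"
  shows "mean_abs I a (- c) = mean_abs I a c"
  using assms
proof (induction I arbitrary: c rule: finite_induct)
  case (insert i I)
  show ?case
    using insert.IH[of "c + a i"] insert.IH[of "c - a i"]
    by (simp add: mean_abs_insert insert.hyps algebra_simps)
qed simp

text \<open>
  Jensen's inequality, in the form \<open>\<bar>c + a\<bar> + \<bar>c - a\<bar> \<ge> 2 * \<bar>c\<bar>\<close> applied one coordinate at a time.
\<close>

lemma mean_abs_ge:
  assumes "finite I"
  shows "mean_abs I a c \<ge> \<bar>c\<bar>"
  using assms
proof (induction I arbitrary: c rule: finite_induct)
  case (insert i I)
  show ?case
    using insert.IH[of "c + a i"] insert.IH[of "c - a i"]
    by (simp add: mean_abs_insert insert.hyps)
qed simp

lemma mean_abs_cong: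
  assumes "\<And>i. i \<in> I \<Longrightarrow> a i = b i"
  shows "mean_abs I a c = mean_abs I b c"
  using assms by (simp add: mean_abs_def signed_sum_def)

lemma mean_abs_insert_self:
  assumes "finite I" "i \<notin> I"
  shows "mean_abs (insert i I) a 0 = mean_abs I a (a i)"
  using mean_abs_minus[OF assms(1), of a "a i"] by (simp add: mean_abs_insert assms)

text \<open>
  Coordinates of weight zero can be discarded; the equality case is studied on the support only.
\<close>

lemma mean_abs_zeros:
  assumes "finite J" "I \<subseteq> J" "\<And>i. i \<in> J - I \<Longrightarrow> a i = 0"
  shows "mean_abs J a c = mean_abs I a c"
proof -
  have "mean_abs (I \<union> L) a c = mean_abs I a c" if "finite L" "L \<subseteq> J - I" for L
    using that
  proof (induction L rule: finite_induct)
    case (insert i L)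
    then have "i \<notin> I \<union> L" "finite (I \<union> L)" "a i = 0"
      using assms by (auto intro: finite_subset[of I J])
    then show ?case using insert by (simp add: mean_abs_insert)
  qed simp
  from this[of "J - I"] show ?thesis using assms by (simp add: Un_absorb1)
qed

lemma signed_sum_second_moment:
  assumes "finite I"
  shows "cube_mean I (\<lambda>P. (c + signed_sum I a P)\<^sup>2) = c\<^sup>2 + (\<Sum>i\<in>I. (a i)\<^sup>2)"
  using assms
proof (induction I arbitrary: c rule: finite_induct)
  case empty
  show ?case by (simp add: signed_sum_def)
next
  case (insert i I)
  have "cube_mean (insert i I) (\<lambda>P. (c + signed_sum (insert i I) a P)\<^sup>2) =
      (cube_mean I (\<lambda>P. (c + a i + signed_sum I a P)\<^sup>2) + cube_mean I (\<lambda>P. (c - a i + signed_sum I a P)\<^sup>2)) / 2"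
    unfolding cube_mean_insert[OF insert.hyps]
    by (intro arg_cong2[where f = "(/)"] arg_cong2[where f = "(+)"] cube_mean_cong refl)
       (simp_all add: signed_sum_insert insert.hyps algebra_simps)
  also have "\<dots> = c\<^sup>2 + (\<Sum>i\<in>insert i I. (a i)\<^sup>2)"
    unfolding insert.IH using insert.hyps by (simp add: power2_eq_square field_simps)
  finally show ?case .
qed

section \<open>Khintchine's inequality with the optimal constant\<close>

text \<open>
  The function \<open>f = \<bar>S\<bar>\<close> is even, hence has no characters of degree one and \<open>cube_poincare_level_two\<close>
  applies with vanishing correction: \<open>E (f * flip_sum f) \<le> (n - 4) * E f\<^sup>2 + 4 * (E f)\<^sup>2\<close>.
  Comparing with the pointwise bound \<open>flip_sum f \<ge> (n - 2) * f\<close> gives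
  \<open>2 * E f\<^sup>2 \<le> 4 * (E f)\<^sup>2\<close>. The amount lost in the pointwise bound is kept, since it must vanish
  in the case of equality.
\<close>

lemma khintchine_with_defect:
  assumes "finite I"
  shows "2 * (\<Sum>i\<in>I. (a i)\<^sup>2)
           + cube_mean I (\<lambda>P. \<bar>signed_sum I a P\<bar> * (flip_sum I (\<lambda>P. \<bar>signed_sum I a P\<bar>) P
               - (real (card I) - 2) * \<bar>signed_sum I a P\<bar>))
         \<le> 4 * (mean_abs I a 0)\<^sup>2"
proof -
  define f where "f = (\<lambda>P. \<bar>signed_sum I a P\<bar>)"
  define n where "n = real (card I)"
  \<comment> \<open>The substitution of \<open>I - P\<close> for \<open>P\<close> preserves \<open>f\<close> and negates every sign.\<close>
  have coeff: "cube_mean I (\<lambda>P. coord_sign P j * f P) = 0" if "j \<in> I" for j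
  proof -
    have "cube_mean I (\<lambda>P. coord_sign P j * f P) = cube_mean I (\<lambda>P. coord_sign (I - P) j * f (I - P))"
      by (rule cube_mean_compl[symmetric])
    also have "\<dots> = cube_mean I (\<lambda>P. (- 1) * (coord_sign P j * f P))"
      using that by (intro cube_mean_cong) (auto simp: f_def signed_sum_compl coord_sign_def)
    finally show ?thesis unfolding cube_mean_cmult by simp
  qed
  have level1: "(\<Sum>j\<in>I. (cube_mean I (\<lambda>P. coord_sign P j * f P))\<^sup>2) = 0"
    by (simp add: coeff)
  have m2: "cube_mean I (\<lambda>P. (f P)\<^sup>2) = (\<Sum>i\<in>I. (a i)\<^sup>2)"
    using signed_sum_second_moment[OF assms, of 0 a] by (simp add: f_def)
  have "cube_mean I (\<lambda>P. f P * (flip_sum I f P - (n - 2) * f P))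
      = cube_mean I (\<lambda>P. f P * flip_sum I f P - (n - 2) * (f P)\<^sup>2)"
    by (rule cube_mean_cong) (simp add: power2_eq_square algebra_simps)
  also have "\<dots> = cube_mean I (\<lambda>P. f P * flip_sum I f P) - (n - 2) * (\<Sum>i\<in>I. (a i)\<^sup>2)"
    by (simp only: cube_mean_diff cube_mean_cmult m2)
  also have "\<dots> \<le> 4 * (cube_mean I f)\<^sup>2 - 2 * (\<Sum>i\<in>I. (a i)\<^sup>2)"
    using cube_poincare_level_two[OF assms, of f] level1 unfolding m2 n_def by (simp add: algebra_simps)
  finally show ?thesis by (simp add: f_def n_def mean_abs_def)
qed

text \<open>
  Szarek's form of Khintchine's inequality, with the optimal constant \<open>1 / sqrt 2\<close>.
\<close>

lemma khintchine:
  assumes "finite I"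
  shows "(\<Sum>i\<in>I. (a i)\<^sup>2) \<le> 2 * (mean_abs I a 0)\<^sup>2"
proof -
  have "0 = cube_mean I (\<lambda>P. 0)" by (simp add: cube_mean_def)
  also have "\<dots> \<le> cube_mean I (\<lambda>P. \<bar>signed_sum I a P\<bar> * (flip_sum I (\<lambda>P. \<bar>signed_sum I a P\<bar>) P
               - (real (card I) - 2) * \<bar>signed_sum I a P\<bar>))"
    using flip_sum_abs_ge[OF assms] by (intro cube_mean_mono) simp
  finally show ?thesis using khintchine_with_defect[OF assms, of a] by simp
qed


section \<open>Equality in Khintchine's inequality\<close>

lemma signed_sum_weight:
  assumes "finite I" "P \<subseteq> I"
  shows "signed_sum I a P = sum a I - 2 * sum a P"
proof -
  have fin: "finite P" using assms finite_subset by blast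
  have "signed_sum I a P = (\<Sum>i\<in>I. a i - 2 * (if i \<in> P then a i else 0))"
    unfolding signed_sum_def by (intro sum.cong refl) (auto simp: coord_sign_def)
  also have "\<dots> = sum a I - 2 * sum a (I \<inter> P)"
    using assms by (simp add: sum_subtractf sum.inter_restrict flip: sum_distrib_left)
  finally show ?thesis using assms by (simp add: Int_absorb1)
qed

text \<open>
  Equality in the triangle inequality of \<open>flip_sum_abs_ge\<close> means that no single flip can carry a
  positive signed sum below zero.
\<close>

lemma flip_sum_tight_same_sign:
  assumes "finite I" "i \<in> I" "signed_sum I a P > 0"
    and tight: "flip_sum I (\<lambda>P. \<bar>signed_sum I a P\<bar>) P = (real (card I) - 2) * \<bar>signed_sum I a P\<bar>"
  shows "signed_sum I a (flip i P) \<ge> 0"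
proof -
  have "(\<Sum>j\<in>I. \<bar>signed_sum I a (flip j P)\<bar> - signed_sum I a (flip j P)) = 0"
    using tight assms(3) flip_sum_signed_sum[OF assms(1), of a P]
    by (simp add: flip_sum_def sum_subtractf)
  then have "\<forall>j\<in>I. \<bar>signed_sum I a (flip j P)\<bar> - signed_sum I a (flip j P) = 0"
    using assms(1) by (subst (asm) sum_nonneg_eq_0_iff) auto
  with assms(2) show ?thesis by force
qed

text \<open>
  In terms of the set \<open>P\<close> of minus signs, the hypothesis says that adding elements to \<open>P\<close> one by one
  cannot jump over half of the total weight, but has to land on it exactly. For a heaviest set \<open>P\<close> below one half
  this forces every outside weight to be the missing amount \<open>c\<close>. Exchanging an inside element \<open>j\<close>
  for outside elements then forces \<open>a j = c\<close> too. The number of weights is even because half of the total is a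
  multiple of \<open>c\<close>.
\<close>

lemma no_crossing_imp_equal_weights:
  fixes a :: "'i \<Rightarrow> real"
  assumes "finite I" "I \<noteq> {}" and pos: "\<And>i. i \<in> I \<Longrightarrow> a i > 0"
    and no_cross: "\<And>P i. P \<subseteq> I \<Longrightarrow> i \<in> I - P \<Longrightarrow> 2 * sum a P < sum a I \<Longrightarrow> 2 * (sum a P + a i) \<le> sum a I"
  obtains c k where "c > 0" "\<And>i. i \<in> I \<Longrightarrow> a i = c" "card I = 2 * Suc k"
proof -
  define T where "T = sum a I"
  define W where "W = {P \<in> Pow I. 2 * sum a P < T}"
  have "T > 0" unfolding T_def using assms(1,2) pos by (intro sum_pos) auto
  then have "{} \<in> W" by (simp add: W_def)
  moreover have finW: "finite W" using assms(1) by (simp add: W_def)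
  ultimately have "Max (sum a ` W) \<in> sum a ` W" by (intro Max_in) auto
  then obtain P where P: "P \<in> W" "sum a P = Max (sum a ` W)" by (metis imageE)
  have maxP: "sum a Q \<le> sum a P" if "Q \<in> W" for Q
    unfolding P(2) using that finW by (intro Max_ge) auto
  have PI: "P \<subseteq> I" "2 * sum a P < T" using P(1) by (auto simp: W_def)
  have finP: "finite P" using PI(1) assms(1) finite_subset by blast
  define c where "c = T / 2 - sum a P"
  have c: "c > 0" using PI by (simp add: c_def)
  have outside: "a i = c" if i: "i \<in> I - P" for i
  proof -
    have s: "sum a (insert i P) = sum a P + a i" using i finP by simp
    have "insert i P \<notin> W" using maxP[of "insert i P"] pos[of i] s i by force
    then have "2 * (sum a P + a i) \<ge> T" using s i PI by (auto simp: W_def)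
    then show ?thesis using no_cross[OF PI(1) i] PI(2) by (simp add: c_def T_def)
  qed
  have "sum a (I - P) = T - sum a P"
    unfolding T_def using assms(1) PI(1) by (simp add: sum_diff)
  moreover have "sum a (I - P) = real (card (I - P)) * c" using outside by simp
  moreover have "sum a P \<ge> 0" using pos PI(1) by (intro sum_nonneg) (auto intro: less_imp_le)
  ultimately have "real (card (I - P)) * c \<ge> 2 * c" by (simp add: c_def)
  then have two: "card (I - P) \<ge> 2" using c by simp
  then have "I - P \<noteq> {}" by (metis card.empty not_numeral_le_zero)
  then obtain i where i: "i \<in> I - P" by blast
  have "card (I - P - {i}) = card (I - P) - 1" using i assms(1) by simp
  then have "I - P - {i} \<noteq> {}" using two by (metis card.empty diff_is_0_eq not_less_eq_eq numeral_2_eq_2 One_nat_def)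
  then obtain i' where i': "i' \<in> I - P" "i' \<noteq> i" by blast
  have inside: "a j = c" if j: "j \<in> P" for j
  proof (rule ccontr)
    assume "a j \<noteq> c"
    \<comment> \<open>The set \<open>Q\<close> falls short of one half by \<open>a j\<close>, so neither \<open>i'\<close> nor, after \<open>i'\<close>, the element \<open>j\<close> may jump over it.\<close>
    define Q where "Q = insert i (P - {j})"
    have Q: "Q \<subseteq> I" "i' \<in> I - Q" "sum a Q = T / 2 - a j"
      using i i' j PI(1) finP outside[OF i] by (auto simp: Q_def sum_diff1 c_def)
    have "a j > 0" using pos j PI(1) by auto
    then have "c < a j"
      using no_cross[OF Q(1,2)] Q(3) outside[OF i'(1)] \<open>a j \<noteq> c\<close> by (simp add: T_def)
    moreover have "sum a (insert i' Q) = T / 2 - a j + c"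
      using Q i'(1) outside[OF i'(1)] finP by (simp add: Q_def)
    moreover have "j \<in> I - insert i' Q" using i i' j PI(1) by (auto simp: Q_def)
    ultimately show False
      using no_cross[of "insert i' Q" j] Q c by (simp add: T_def)
  qed
  have all: "a i = c" if "i \<in> I" for i using inside outside that by blast
  have "sum a P = real (card P) * c" "T = real (card I) * c"
    using all PI(1) by (simp_all add: T_def subset_iff)
  then have "real (card I) * c = 2 * (real (card P) * c) + 2 * c"
    using c_def by linarith
  also have "\<dots> = real (2 * Suc (card P)) * c" by (simp add: algebra_simps)
  finally have "real (card I) = real (2 * Suc (card P))"
    using c by (simp only: mult_cancel_right) simp
  then have "card I = 2 * Suc (card P)" by (simp only: of_nat_eq_iff)
  with c all show ?thesis by (intro that)
qed

text \<open>
  An even number of equal weights \<open>c\<close>, where \<open>z\<close> is the probability that the signed sum \<open>S\<close> vanishes.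
  The nonzero values of \<open>S\<close> have modulus at least \<open>2 * c\<close>. So at such points the bound in
  \<open>flip_sum_abs_ge\<close> is an equality, and the zeros of \<open>S\<close> alone account for the difference; averaging
  over the cube relates \<open>E \<bar>S\<bar>\<close> to \<open>z\<close>. Likewise \<open>\<bar>S + 2 * c\<bar>\<close> and \<open>\<bar>S - 2 * c\<bar>\<close> have the mean
  \<open>\<bar>S\<bar>\<close> except where \<open>S = 0\<close>.
\<close>

lemma constant_weights_zero_probability:
  assumes "finite I" "card I = 2 * k" "c > 0" and const: "\<And>i. i \<in> I \<Longrightarrow> a i = c"
  defines "z \<equiv> cube_mean I (\<lambda>P. if signed_sum I a P = 0 then 1 else 0)"
  shows "mean_abs I a 0 = 2 * real k * c * z"
    and "mean_abs I a (2 * c) = mean_abs I a 0 + 2 * c * z"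
proof -
  let ?S = "signed_sum I a"
  have gap: "?S P = 0 \<or> ?S P \<ge> 2 * c \<or> ?S P \<le> - 2 * c" if "P \<subseteq> I" for P
  proof -
    have "sum a P = real (card P) * c" using const that by (simp add: subset_iff)
    moreover have "sum a I = 2 * real k * c" using const assms(2) by simp
    ultimately have S: "?S P = 2 * c * of_int (int k - int (card P))"
      using signed_sum_weight[OF assms(1) that, of a] by (simp add: algebra_simps)
    consider "int k - int (card P) = 0" | "int k - int (card P) \<ge> 1" | "int k - int (card P) \<le> -1"
      by linarith
    then show ?thesis
    proof cases
      case 1
      then show ?thesis using S by simp
    next
      case 2
      then have "(1::real) \<le> of_int (int k - int (card P))" by linarith
      then have "2 * c * 1 \<le> ?S P" unfolding S using assms(3) by (intro mult_left_mono) auto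
      then show ?thesis by simp
    next
      case 3
      then have "of_int (int k - int (card P)) \<le> (-1::real)" by linarith
      then have "?S P \<le> 2 * c * (-1)" unfolding S using assms(3) by (intro mult_left_mono) auto
      then show ?thesis by simp
    qed
  qed
  have sgn: "coord_sign P i = 1 \<or> coord_sign P i = -1" for P i by (simp add: coord_sign_def)
  have flips: "flip_sum I (\<lambda>P. \<bar>?S P\<bar>) P
      = (2 * real k - 2) * \<bar>?S P\<bar> + 4 * real k * c * (if ?S P = 0 then 1 else 0)"
    if P: "P \<subseteq> I" for P
  proof -
    have step: "?S (flip i P) = ?S P - 2 * c * coord_sign P i" if "i \<in> I" for i
      using signed_sum_flip[OF assms(1) that] const that by simp
    consider "?S P = 0" | "?S P \<ge> 2 * c" | "?S P \<le> - 2 * c" using gap[OF P] by blast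
    then show ?thesis
    proof cases
      case 1
      have "\<bar>?S (flip i P)\<bar> = 2 * c" if "i \<in> I" for i
        using step[OF that] 1 sgn[of P i] assms(3) by auto
      then show ?thesis using 1 assms(2) by (simp add: flip_sum_def)
    next
      case 2
      have "\<bar>?S (flip i P)\<bar> = ?S (flip i P)" if "i \<in> I" for i
        using step[OF that] 2 sgn[of P i] assms(3) by auto
      then have "flip_sum I (\<lambda>P. \<bar>?S P\<bar>) P = flip_sum I ?S P" by (simp add: flip_sum_def)
      then show ?thesis using 2 assms(2,3) by (simp add: flip_sum_signed_sum[OF assms(1)])
    next
      case 3
      have "\<bar>?S (flip i P)\<bar> = - ?S (flip i P)" if "i \<in> I" for i
        using step[OF that] 3 sgn[of P i] assms(3) by auto
      then have "flip_sum I (\<lambda>P. \<bar>?S P\<bar>) P = - flip_sum I ?S P"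
        by (simp add: flip_sum_def sum_negf)
      then show ?thesis using 3 assms(2,3) by (simp add: flip_sum_signed_sum[OF assms(1)])
    qed
  qed
  have m: "mean_abs I a 0 = cube_mean I (\<lambda>P. \<bar>?S P\<bar>)" by (simp add: mean_abs_def)
  have "cube_mean I (flip_sum I (\<lambda>P. \<bar>?S P\<bar>)) = (\<Sum>i\<in>I. cube_mean I (\<lambda>P. \<bar>?S (flip i P)\<bar>))"
    unfolding flip_sum_def by (rule cube_mean_sum)
  also have "\<dots> = 2 * real k * mean_abs I a 0"
    using cube_mean_flip[of _ I "\<lambda>P. \<bar>?S P\<bar>"] assms(2) by (simp add: m)
  finally have "2 * real k * mean_abs I a 0 = cube_mean I (flip_sum I (\<lambda>P. \<bar>?S P\<bar>))" ..
  also have "\<dots> = cube_mean I (\<lambda>P. (2 * real k - 2) * \<bar>?S P\<bar> + 4 * real k * c * (if ?S P = 0 then 1 else 0))"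
    by (rule cube_mean_cong) (rule flips)
  also have "\<dots> = (2 * real k - 2) * mean_abs I a 0 + 4 * real k * c * z"
    by (simp only: cube_mean_add cube_mean_cmult m z_def)
  finally show "mean_abs I a 0 = 2 * real k * c * z" by (simp add: algebra_simps)
  have "mean_abs I a (2 * c) = (mean_abs I a (2 * c) + mean_abs I a (- (2 * c))) / 2"
    by (simp add: mean_abs_minus assms(1))
  also have "\<dots> = cube_mean I (\<lambda>P. (1 / 2) * (\<bar>2 * c + ?S P\<bar> + \<bar>- (2 * c) + ?S P\<bar>))"
    unfolding cube_mean_cmult cube_mean_add by (simp add: mean_abs_def)
  also have "\<dots> = cube_mean I (\<lambda>P. \<bar>?S P\<bar> + 2 * c * (if ?S P = 0 then 1 else 0))"
  proof (rule cube_mean_cong)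
    fix P assume "P \<subseteq> I"
    from gap[OF this] show "(1 / 2) * (\<bar>2 * c + ?S P\<bar> + \<bar>- (2 * c) + ?S P\<bar>)
        = \<bar>?S P\<bar> + 2 * c * (if ?S P = 0 then 1 else 0)"
      using assms(3) by auto
  qed
  also have "\<dots> = mean_abs I a 0 + 2 * c * z"
    by (simp only: cube_mean_add cube_mean_cmult m z_def)
  finally show "mean_abs I a (2 * c) = mean_abs I a 0 + 2 * c * z" .
qed

text \<open>
  An even number of equal weights passes all pointwise equality tests, so four or more need a separate argument. Passing from
  \<open>2 * k\<close> to \<open>2 * k + 2\<close> equal weights multiplies \<open>E \<bar>S\<bar>\<close> by \<open>(2 * k + 1) / (2 * k)\<close>, and
  \<open>((2 * k + 1) / (2 * k))\<^sup>2 > (k + 1) / k\<close>. Hence the inequality for the smaller number of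
  weights implies the strict one for the larger number.
\<close>

lemma khintchine_strict_constant:
  assumes "finite I" "card I = 2 * k + 2" "k > 0" "c > 0" and const: "\<And>i. i \<in> I \<Longrightarrow> a i = c"
  shows "(\<Sum>i\<in>I. (a i)\<^sup>2) < 2 * (mean_abs I a 0)\<^sup>2"
proof -
  obtain i L where L: "I = insert i L" "i \<notin> L" "card L = 2 * k + 1"
    using card_eq_SucD[of I "2 * k + 1"] assms(2) by auto
  obtain j J where J: "L = insert j J" "j \<notin> J" "card J = 2 * k"
    using card_eq_SucD[of L "2 * k"] L(3) by auto
  have fin: "finite J" "finite L" using assms(1) L J by auto
  define z where "z = cube_mean J (\<lambda>P. if signed_sum J a P = 0 then 1 else 0)"
  have zJ: "mean_abs J a 0 = 2 * real k * c * z" "mean_abs J a (2 * c) = mean_abs J a 0 + 2 * c * z"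
    unfolding z_def
    by (rule constant_weights_zero_probability[OF fin(1) J(3) assms(4)]; use const L J in auto)+
  have "mean_abs I a 0 = (mean_abs J a (2 * c) + mean_abs J a 0) / 2"
    using mean_abs_insert_self[OF fin(2) L(2), of a] mean_abs_insert[OF fin(1) J(2), of a c] const L J
    by simp
  also have "\<dots> = (2 * real k + 1) * (c * z)" using zJ by (simp add: algebra_simps)
  finally have mI: "mean_abs I a 0 = (2 * real k + 1) * (c * z)" .
  have "(\<Sum>i\<in>J. (a i)\<^sup>2) = 2 * real k * c\<^sup>2" using const L J by simp
  then have "2 * real k * c\<^sup>2 \<le> 2 * (2 * real k * (c * z))\<^sup>2"
    using khintchine[OF fin(1), of a] zJ(1) by (simp add: mult.assoc)
  then have "real k * c\<^sup>2 \<le> real k * (4 * real k * (c * z)\<^sup>2)"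
    by (simp add: power_mult_distrib power2_eq_square algebra_simps)
  then have lower: "c\<^sup>2 \<le> 4 * real k * (c * z)\<^sup>2" using assms(3) by simp
  then have "(c * z)\<^sup>2 > 0" using assms(4) by (cases "c * z = 0") auto
  have "(\<Sum>i\<in>I. (a i)\<^sup>2) = (2 * real k + 2) * c\<^sup>2" using const assms(2) by simp
  also have "\<dots> \<le> (2 * real k + 2) * (4 * real k * (c * z)\<^sup>2)"
    by (rule mult_left_mono[OF lower]) simp
  also have "\<dots> < 2 * ((2 * real k + 1) * (c * z))\<^sup>2"
    using \<open>(c * z)\<^sup>2 > 0\<close> by (simp add: power_mult_distrib power2_eq_square algebra_simps)
  finally show ?thesis by (simp add: mI)
qed

text \<open>
  Equality makes the defect in \<open>khintchine_with_defect\<close> vanish at every point of the cube, so the nonzero weights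
  are an even number of equal ones, and four or more are excluded by \<open>khintchine_strict_constant\<close>.
\<close>

lemma khintchine_equality:
  assumes fin: "finite I" and nonneg: "\<And>i. i \<in> I \<Longrightarrow> a i \<ge> 0"
    and eq: "(\<Sum>i\<in>I. (a i)\<^sup>2) = 2 * (mean_abs I a 0)\<^sup>2"
  shows "(\<forall>i\<in>I. a i = 0) \<or>
    (\<exists>p\<in>I. \<exists>q\<in>I. p \<noteq> q \<and> a p = a q \<and> a p > 0 \<and> (\<forall>i\<in>I - {p, q}. a i = 0))"
proof -
  define J where "J = {i \<in> I. a i \<noteq> 0}"
  have J: "finite J" "J \<subseteq> I" "\<And>i. i \<in> J \<Longrightarrow> a i > 0" "\<And>i. i \<in> I - J \<Longrightarrow> a i = 0"
    using fin nonneg by (auto simp: J_def less_le)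
  have "(\<Sum>i\<in>I. (a i)\<^sup>2) = (\<Sum>i\<in>J. (a i)\<^sup>2)"
    by (rule sum.mono_neutral_right) (use fin J in auto)
  then have eqJ: "(\<Sum>i\<in>J. (a i)\<^sup>2) = 2 * (mean_abs J a 0)\<^sup>2"
    using eq mean_abs_zeros[OF fin J(2,4), where c = 0] by simp
  let ?S = "signed_sum J a"
  let ?defect = "\<lambda>P. \<bar>?S P\<bar> * (flip_sum J (\<lambda>P. \<bar>?S P\<bar>) P - (real (card J) - 2) * \<bar>?S P\<bar>)"
  have defect_nonneg: "?defect P \<ge> 0" for P
    using flip_sum_abs_ge[OF J(1), of a P] by simp
  have "cube_mean J ?defect \<le> 0"
    using khintchine_with_defect[OF J(1), of a] eqJ by simp
  moreover have "cube_mean J ?defect \<ge> 0"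
    using defect_nonneg by (simp add: cube_mean_def sum_nonneg)
  ultimately have tight: "?defect P = 0" if "P \<subseteq> J" for P
    using cube_mean_eq_0D[OF J(1), of ?defect P] defect_nonneg that by simp
  have no_cross: "2 * (sum a P + a i) \<le> sum a J"
    if "P \<subseteq> J" "i \<in> J - P" "2 * sum a P < sum a J" for P i
  proof -
    have pos: "?S P > 0" using that by (simp add: signed_sum_weight J(1))
    then have "?S (flip i P) \<ge> 0"
      using tight[OF that(1)] that(2) by (intro flip_sum_tight_same_sign[OF J(1)]) auto
    then show ?thesis
      using that signed_sum_weight[OF J(1) that(1), of a]
        signed_sum_flip[OF J(1), of i a P] by (simp add: coord_sign_def)
  qed
  show ?thesis
  proof (cases "J = {}")
    case True
    then show ?thesis by (auto simp: J_def)
  next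
    case False
    obtain c k where c: "c > 0" "\<And>i. i \<in> J \<Longrightarrow> a i = c" "card J = 2 * Suc k"
      using no_crossing_imp_equal_weights[OF J(1) False, of a] J(3) no_cross by auto
    have "k = 0"
      using khintchine_strict_constant[OF J(1), of k c a] c eqJ by fastforce
    then obtain p q where pq: "J = {p, q}" "p \<noteq> q" using c(3) by (auto simp: card_2_iff)
    then show ?thesis using c J(2-4) by (intro disjI2 bexI[of _ p] bexI[of _ q]) auto
  qed
qed

section \<open>Rademacher sums as means over the cube\<close>

lemma rademacher_AE:
  assumes "rademacher M X"
  shows "AE x in M. X x = 1 \<or> X x = -1"
proof -
  have meas [measurable]: "X \<in> borel_measurable M" using assms by (simp add: rademacher_def)
  let ?p = "measure_pmf (pmf_of_set {-1, 1::real})"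
  have "AE y in distr ?p borel (\<lambda>x. x). y = 1 \<or> y = -1"
    by (subst AE_distr_iff) (auto simp: AE_measure_pmf_iff)
  moreover have "distr M borel X = distr ?p borel (\<lambda>x. x)" using assms by (simp add: rademacher_def)
  ultimately have "AE y in distr M borel X. y = 1 \<or> y = -1" by (simp only:)
  then show ?thesis by (simp add: AE_distr_iff)
qed

lemma rademacher_expectation:
  assumes "rademacher M X"
  shows "(LINT x|M. X x) = 0"
proof -
  have meas [measurable]: "X \<in> borel_measurable M" using assms by (simp add: rademacher_def)
  let ?p = "measure_pmf (pmf_of_set {-1, 1::real})"
  have "(LINT x|M. X x) = (LINT y|distr M borel X. y)" by (simp add: integral_distr)
  also have "\<dots> = (LINT y|distr ?p borel (\<lambda>x. x). y)" using assms by (simp add: rademacher_def)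
  also have "\<dots> = (LINT y|?p. y)" by (simp add: integral_distr)
  also have "\<dots> = 0" by (simp add: integral_pmf_of_set)
  finally show ?thesis .
qed

lemma (in prob_space) rademacher_integrable:
  assumes "rademacher M X"
  shows "integrable M X"
proof (rule integrable_const_bound[where B = 1])
  show "AE x in M. norm (X x) \<le> 1" using rademacher_AE[OF assms] by eventually_elim auto
  show "X \<in> borel_measurable M" using assms by (simp add: rademacher_def)
qed

text \<open>
  Both sides obey the same recursion in the index set. For a sign \<open>\<epsilon>\<close>, any function of \<open>\<epsilon>\<close> equals its
  average over the two signs plus \<open>\<epsilon>\<close> times half the difference, and by independence the latter term has mean zero.
\<close>

lemma (in prob_space) expectation_abs_rademacher_sum:
  assumes "finite I" "indep_vars (\<lambda>_. borel) \<epsilon> I" "\<And>i. i \<in> I \<Longrightarrow> rademacher M (\<epsilon> i)"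
  shows "(LINT x|M. \<bar>c + (\<Sum>i\<in>I. \<omega> i * \<epsilon> i x)\<bar>) = mean_abs I \<omega> c"
  using assms
proof (induction I arbitrary: c rule: finite_induct)
  case empty
  show ?case by (simp add: prob_space)
next
  case (insert i I)
  define Y where "Y = (\<lambda>x. \<Sum>j\<in>I. \<omega> j * \<epsilon> j x)"
  define A where "A = (\<lambda>s y::real. \<bar>c + s * \<omega> i + y\<bar>)"
  define g where "g = (\<lambda>y. (A 1 y - A (-1) y) / 2)"
  have [measurable]: "g \<in> borel_measurable borel" unfolding g_def A_def by measurable
  have IH: "(LINT x|M. \<bar>d + Y x\<bar>) = mean_abs I \<omega> d" for d
    unfolding Y_def using insert.prems by (intro insert.IH) (auto intro: indep_vars_subset)
  have int_eps: "integrable M (\<epsilon> j)" if "j \<in> insert i I" for j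
    using insert.prems(2)[OF that] by (rule rademacher_integrable)
  have "integrable M Y"
    unfolding Y_def using int_eps by (intro Bochner_Integration.integrable_sum integrable_mult_right) auto
  then have int_A: "integrable M (\<lambda>x. A s (Y x))" for s
    unfolding A_def by (intro integrable_abs Bochner_Integration.integrable_add) auto
  then have int_g: "integrable M (\<lambda>x. g (Y x))"
    unfolding g_def by (intro Bochner_Integration.integrable_divide Bochner_Integration.integrable_diff)
  have "indep_vars (\<lambda>_. borel) (\<lambda>j x. (if j = i then 1 else \<omega> j) * \<epsilon> j x) (insert i I)"
    by (rule indep_vars_compose2[OF insert.prems(1)]) simp
  from indep_vars_sum[OF insert.hyps this]
  have "indep_var borel (\<epsilon> i) borel (\<lambda>x. \<Sum>j\<in>I. (if j = i then 1 else \<omega> j) * \<epsilon> j x)" by simp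
  also have "(\<lambda>x. \<Sum>j\<in>I. (if j = i then 1 else \<omega> j) * \<epsilon> j x) = Y"
    unfolding Y_def using insert.hyps by (intro ext sum.cong) auto
  finally have "indep_var borel ((\<lambda>x. x) \<circ> \<epsilon> i) borel (g \<circ> Y)"
    by (rule indep_var_compose) simp_all
  then have indep: "indep_var borel (\<epsilon> i) borel (\<lambda>x. g (Y x))" by (simp add: comp_def)
  note product = indep_var_lebesgue_integral[OF indep int_eps[OF insertI1] int_g]
    indep_var_integrable[OF indep int_eps[OF insertI1] int_g]
  have [measurable]: "\<epsilon> j \<in> borel_measurable M" if "j \<in> insert i I" for j
    using int_eps[OF that] by (rule borel_measurable_integrable)
  have "(LINT x|M. \<bar>c + (\<Sum>j\<in>insert i I. \<omega> j * \<epsilon> j x)\<bar>)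
      = (LINT x|M. (A 1 (Y x) + A (-1) (Y x)) / 2 + \<epsilon> i x * g (Y x))"
  proof (rule integral_cong_AE)
    show "(\<lambda>x. \<bar>c + (\<Sum>j\<in>insert i I. \<omega> j * \<epsilon> j x)\<bar>) \<in> borel_measurable M" by measurable
    show "(\<lambda>x. (A 1 (Y x) + A (-1) (Y x)) / 2 + \<epsilon> i x * g (Y x)) \<in> borel_measurable M"
      unfolding A_def g_def Y_def by measurable
    show "AE x in M. \<bar>c + (\<Sum>j\<in>insert i I. \<omega> j * \<epsilon> j x)\<bar>
        = (A 1 (Y x) + A (-1) (Y x)) / 2 + \<epsilon> i x * g (Y x)"
      using rademacher_AE[OF insert.prems(2)[OF insertI1]]
    proof eventually_elim
      case (elim x)
      have "(\<Sum>j\<in>insert i I. \<omega> j * \<epsilon> j x) = \<omega> i * \<epsilon> i x + Y x"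
        using insert.hyps by (simp add: Y_def)
      then show ?case using elim by (auto simp: A_def g_def field_simps)
    qed
  qed
  also have "\<dots> = (LINT x|M. (A 1 (Y x) + A (-1) (Y x)) / 2) + (LINT x|M. \<epsilon> i x * g (Y x))"
    by (rule Bochner_Integration.integral_add)
       (intro Bochner_Integration.integrable_divide Bochner_Integration.integrable_add int_A product(2))+
  also have "(LINT x|M. \<epsilon> i x * g (Y x)) = 0"
    using product(1) rademacher_expectation[OF insert.prems(2)[OF insertI1]] by simp
  also have "(LINT x|M. (A 1 (Y x) + A (-1) (Y x)) / 2)
      = ((LINT x|M. A 1 (Y x)) + (LINT x|M. A (-1) (Y x))) / 2"
    using int_A by simp
  also have "\<dots> = mean_abs (insert i I) \<omega> c"
    by (simp add: A_def IH mean_abs_insert insert.hyps)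
  finally show ?case by simp
qed

section \<open>The first two coordinates and the extremal vector\<close>

lemma mean_abs_split_first_two:
  fixes n :: nat
  assumes "2 \<le> n"
  shows "mean_abs {1..n} \<omega> 0 = (mean_abs {3..n} \<omega> (\<omega> 1 + \<omega> 2) + mean_abs {3..n} \<omega> (\<omega> 1 - \<omega> 2)) / 2"
proof -
  have e: "{1..n} = insert 1 (insert 2 {3..n})" using assms by auto
  show ?thesis unfolding e
    by (subst mean_abs_insert_self) (auto simp: mean_abs_insert)
qed

text \<open>
  By symmetry the offset acts like one more weight, attached here to the unused index \<open>i\<close>.
\<close>

lemma khintchine_affine:
  assumes "finite I" "i \<notin> I"
  shows "c\<^sup>2 + (\<Sum>j\<in>I. (\<omega> j)\<^sup>2) \<le> 2 * (mean_abs I \<omega> c)\<^sup>2"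
proof -
  let ?v = "fun_upd \<omega> i c"
  have "mean_abs (insert i I) ?v 0 = mean_abs I ?v c"
    using mean_abs_insert_self[OF assms, of ?v] by simp
  also have "\<dots> = mean_abs I \<omega> c" using assms by (intro mean_abs_cong) auto
  finally have "mean_abs (insert i I) ?v 0 = mean_abs I \<omega> c" .
  moreover have "(\<Sum>j\<in>I. (?v j)\<^sup>2) = (\<Sum>j\<in>I. (\<omega> j)\<^sup>2)" using assms by (intro sum.cong) auto
  ultimately show ?thesis using khintchine[of "insert i I" ?v] assms by simp
qed

text \<open>
  In terms of the entries \<open>r, s\<close> of the extremal vector the asserted bound is \<open>r + s / 2\<close>, and the range of
  \<open>\<tau>\<close> in the optimality statement is the one in which the extremal vector is decreasing.
\<close>

lemma omega_tau_norms:
  assumes "0 \<le> \<tau>" "\<tau>\<^sup>2 \<le> 2"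
  defines "r \<equiv> (1 - \<tau>\<^sup>2 / 2) / sqrt 2" and "s \<equiv> \<tau> / sqrt 2 * sqrt (1 - \<tau>\<^sup>2 / 4)"
  shows "0 \<le> r" "0 \<le> s" "2 * r\<^sup>2 + 2 * s\<^sup>2 = 1" "2 * sqrt 2 * r = 2 - \<tau>\<^sup>2"
    "1 / sqrt 2 + (sqrt (1 - \<tau>\<^sup>2 / 4) - \<tau>) * (\<tau> / (2 * sqrt 2)) = r + s / 2"
    "\<tau> \<le> sqrt (2 - sqrt 2) \<Longrightarrow> s \<le> r"
proof -
  have root: "(sqrt (1 - \<tau>\<^sup>2 / 4))\<^sup>2 = 1 - \<tau>\<^sup>2 / 4" using assms(2) by simp
  show r: "0 \<le> r" and s: "0 \<le> s" using assms(1,2) by (simp_all add: r_def s_def)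
  have "2 * r\<^sup>2 = (1 - \<tau>\<^sup>2 / 2)\<^sup>2" by (simp add: r_def power_divide)
  moreover have "2 * s\<^sup>2 = \<tau>\<^sup>2 * (1 - \<tau>\<^sup>2 / 4)"
    by (simp only: s_def power_mult_distrib power_divide root) simp
  ultimately show norm: "2 * r\<^sup>2 + 2 * s\<^sup>2 = 1" by (simp add: power2_eq_square field_simps)
  show "2 * sqrt 2 * r = 2 - \<tau>\<^sup>2" by (simp add: r_def field_simps)
  show "1 / sqrt 2 + (sqrt (1 - \<tau>\<^sup>2 / 4) - \<tau>) * (\<tau> / (2 * sqrt 2)) = r + s / 2"
    by (simp add: r_def s_def power2_eq_square field_simps)
  assume "\<tau> \<le> sqrt (2 - sqrt 2)"
  then have "\<tau>\<^sup>2 \<le> (sqrt (2 - sqrt 2))\<^sup>2" using assms(1) by (rule power_mono)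
  moreover have "sqrt 2 \<le> (2::real)" by (rule real_le_lsqrt) simp_all
  ultimately have "\<tau>\<^sup>2 \<le> 2 - sqrt 2" by simp
  then have "sqrt 2 / 2 \<le> 1 - \<tau>\<^sup>2 / 2" by simp
  then have "sqrt 2 / 2 / sqrt 2 \<le> r" unfolding r_def by (rule divide_right_mono) simp
  then have "1 / 2 \<le> r" by simp
  then have "(1 / 2)\<^sup>2 \<le> r\<^sup>2" by (rule power_mono) simp
  then have "s\<^sup>2 \<le> r\<^sup>2" using norm by (simp add: power2_eq_square)
  then show "s \<le> r" using r by (rule power2_le_imp_le)
qed

lemma sum_first_two:
  fixes f :: "nat \<Rightarrow> real"
  assumes "2 \<le> n"
  shows "(\<Sum>i=1..n. f i) = f 1 + f 2 + (\<Sum>i=3..n. f i)"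
proof -
  have e: "{1..n} = insert 1 (insert 2 {3..n})" using assms by auto
  show ?thesis unfolding e by simp
qed

text \<open>
  Distance \<open>\<tau>\<close> from \<open>omega_star\<close> only prescribes the sum of the first two entries, because both vectors have
  norm one.
\<close>

lemma C_iff:
  assumes "2 \<le> n" "0 \<le> \<tau>"
  shows "\<omega> \<in> C n \<tau> \<longleftrightarrow> \<omega> \<in> real_space n \<and> antimono_on {1..n} \<omega> \<and> (\<forall>i\<in>{1..n}. 0 \<le> \<omega> i) \<and>
    (\<omega> 1)\<^sup>2 + (\<omega> 2)\<^sup>2 + (\<Sum>i=3..n. (\<omega> i)\<^sup>2) = 1 \<and> sqrt 2 * (\<omega> 1 + \<omega> 2) = 2 - \<tau>\<^sup>2"
proof -
  let ?N = "(\<omega> 1)\<^sup>2 + (\<omega> 2)\<^sup>2 + (\<Sum>i=3..n. (\<omega> i)\<^sup>2)"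
  have "(\<Sum>i=3..n. (\<omega> i - omega_star i)\<^sup>2) = (\<Sum>i=3..n. (\<omega> i)\<^sup>2)"
    by (intro sum.cong) (auto simp: omega_star_def)
  then have "(\<Sum>i=1..n. (\<omega> i - omega_star i)\<^sup>2)
      = (\<omega> 1 - 1 / sqrt 2)\<^sup>2 + (\<omega> 2 - 1 / sqrt 2)\<^sup>2 + (\<Sum>i=3..n. (\<omega> i)\<^sup>2)"
    unfolding sum_first_two[OF assms(1)] by (simp add: omega_star_def)
  also have "\<dots> = ?N + 1 - sqrt 2 * (\<omega> 1 + \<omega> 2)"
    by (simp add: power2_diff power_divide field_simps)
  finally have dist: "L2_set (\<lambda>i. \<omega> i - omega_star i) {1..n} = \<tau>
      \<longleftrightarrow> ?N + 1 - sqrt 2 * (\<omega> 1 + \<omega> 2) = \<tau>\<^sup>2"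
    using assms(2) sum_nonneg[of "{1..n}" "\<lambda>i. (\<omega> i - omega_star i)\<^sup>2"]
    by (auto simp: L2_set_def real_sqrt_eq_iff real_sqrt_unique)
  have "L2_set \<omega> {1..n} = 1 \<longleftrightarrow> ?N = 1"
    unfolding L2_set_def sum_first_two[OF assms(1)] by simp
  then show ?thesis unfolding C_def proper_unit_vectors_def using dist by auto
qed


text \<open>
  The two halves \<open>A\<close> and \<open>B\<close> of the mean are bounded by Jensen's inequality and by Khintchine's inequality for the
  weights \<open>\<omega> 1 - \<omega> 2, \<omega> 3, \<dots>, \<omega> n\<close>. Equality requires equality in the bound for \<open>B\<close>, which first
  forces \<open>\<omega> 1 = \<omega> 2\<close> and then leaves at most two equal nonzero weights in the tail; by monotonicity these
  are \<open>\<omega> 3\<close> and \<open>\<omega> 4\<close>.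
\<close>

lemma extremal_bound:
  assumes n: "2 \<le> n" and \<tau>: "0 \<le> \<tau>" and \<omega>: "\<omega> \<in> C n \<tau>"
  defines "b \<equiv> 1 / sqrt 2 + (sqrt (1 - \<tau>\<^sup>2 / 4) - \<tau>) * (\<tau> / (2 * sqrt 2))"
  shows "b \<le> mean_abs {1..n} \<omega> 0" "mean_abs {1..n} \<omega> 0 = b \<Longrightarrow> \<omega> = omega_tau \<tau>"
proof -
  have supp: "\<And>i. i \<notin> {1..n} \<Longrightarrow> \<omega> i = 0" and anti: "antimono_on {1..n} \<omega>"
    and nonneg: "\<And>i. i \<in> {1..n} \<Longrightarrow> 0 \<le> \<omega> i"
    and unit: "(\<omega> 1)\<^sup>2 + (\<omega> 2)\<^sup>2 + (\<Sum>i=3..n. (\<omega> i)\<^sup>2) = 1"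
    and first: "sqrt 2 * (\<omega> 1 + \<omega> 2) = 2 - \<tau>\<^sup>2"
    using \<omega> unfolding C_iff[OF n \<tau>] real_space_def by auto
  define r where "r = (1 - \<tau>\<^sup>2 / 2) / sqrt 2"
  define s where "s = \<tau> / sqrt 2 * sqrt (1 - \<tau>\<^sup>2 / 4)"
  have "0 \<le> sqrt 2 * (\<omega> 1 + \<omega> 2)" using nonneg n by simp
  then have "\<tau>\<^sup>2 \<le> 2" using first by simp
  note rs = omega_tau_norms(1-5)[OF \<tau> this, folded r_def s_def b_def]
  define d where "d = \<omega> 1 - \<omega> 2"
  define \<sigma> where "\<sigma> = (\<Sum>i=3..n. (\<omega> i)\<^sup>2)"
  have "sqrt 2 * (\<omega> 1 + \<omega> 2) = sqrt 2 * (2 * r)" using first rs(4) by simp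
  then have sum12: "\<omega> 1 + \<omega> 2 = 2 * r" by (simp only: mult_cancel_left) simp
  have "(\<omega> 1)\<^sup>2 + (\<omega> 2)\<^sup>2 = (\<omega> 1 + \<omega> 2)\<^sup>2 / 2 + d\<^sup>2 / 2"
    by (simp add: d_def power2_eq_square field_simps)
  also have "\<dots> = 2 * r\<^sup>2 + d\<^sup>2 / 2" unfolding sum12 by (simp add: power_mult_distrib)
  finally have tail: "\<sigma> = 2 * s\<^sup>2 - d\<^sup>2 / 2" using unit rs(3) by (simp add: \<sigma>_def)
  define A where "A = mean_abs {3..n} \<omega> (2 * r)"
  define B where "B = mean_abs {3..n} \<omega> d"
  have K: "mean_abs {1..n} \<omega> 0 = (A + B) / 2"
    unfolding mean_abs_split_first_two[OF n] sum12 A_def B_def d_def ..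
  have A: "2 * r \<le> A" using mean_abs_ge[of "{3..n}" "2 * r" \<omega>] rs(1) by (simp add: A_def)
  have B_nonneg: "0 \<le> B" using mean_abs_ge[of "{3..n}" d \<omega>] by (simp add: B_def)
  have "d\<^sup>2 + \<sigma> \<le> 2 * B\<^sup>2"
    unfolding B_def \<sigma>_def by (rule khintchine_affine[where i = 1]) auto
  then have B_sq: "s\<^sup>2 + d\<^sup>2 / 4 \<le> B\<^sup>2" using tail by simp
  then have "s\<^sup>2 \<le> B\<^sup>2" using zero_le_power2[of d] by linarith
  then have B: "s \<le> B" using B_nonneg by (rule power2_le_imp_le)
  show "b \<le> mean_abs {1..n} \<omega> 0" unfolding K rs(5) using A B by simp
  assume "mean_abs {1..n} \<omega> 0 = b"
  then have Bs: "B = s" unfolding K rs(5) using A B by simp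
  then have d0: "d = 0" using B_sq by simp
  then have \<omega>12: "\<omega> 1 = r" "\<omega> 2 = r" using sum12 by (simp_all add: d_def)
  have \<sigma>: "\<sigma> = 2 * s\<^sup>2" using tail d0 by simp
  have "(\<Sum>i=3..n. (\<omega> i)\<^sup>2) = 2 * (mean_abs {3..n} \<omega> 0)\<^sup>2"
    using \<sigma> Bs d0 by (simp add: \<sigma>_def B_def)
  then have cases: "(\<forall>i\<in>{3..n}. \<omega> i = 0) \<or>
      (\<exists>p\<in>{3..n}. \<exists>q\<in>{3..n}. p \<noteq> q \<and> \<omega> p = \<omega> q \<and> \<omega> p > 0 \<and> (\<forall>i\<in>{3..n} - {p, q}. \<omega> i = 0))"
    using nonneg by (intro khintchine_equality) auto
  have tail_values: "\<omega> 3 = s \<and> \<omega> 4 = s \<and> (\<forall>i\<ge>5. \<omega> i = 0)"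
    using cases
  proof
    assume zero: "\<forall>i\<in>{3..n}. \<omega> i = 0"
    then have "\<sigma> = 0" by (simp add: \<sigma>_def)
    then have "s = 0" using \<sigma> by simp
    moreover have "\<omega> i = 0" if "i \<ge> 3" for i using zero supp[of i] that by (cases "i \<le> n") auto
    ultimately show ?thesis by simp
  next
    assume "\<exists>p\<in>{3..n}. \<exists>q\<in>{3..n}. p \<noteq> q \<and> \<omega> p = \<omega> q \<and> \<omega> p > 0 \<and> (\<forall>i\<in>{3..n} - {p, q}. \<omega> i = 0)"
    then obtain p q where pq: "p \<in> {3..n}" "q \<in> {3..n}" "p < q" "\<omega> p = \<omega> q" "\<omega> p > 0"
      and rest: "\<And>i. i \<in> {3..n} \<Longrightarrow> i \<noteq> p \<Longrightarrow> i \<noteq> q \<Longrightarrow> \<omega> i = 0"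
    proof (elim bexE conjE)
      fix p q
      assume "p \<in> {3..n}" "q \<in> {3..n}" "p \<noteq> q" "\<omega> p = \<omega> q" "\<omega> p > 0"
        and "\<forall>i\<in>{3..n} - {p, q}. \<omega> i = 0"
      then show thesis using that[of p q] that[of q p] by (cases "p < q") auto
    qed
    have le: "\<omega> j \<le> \<omega> i" if "3 \<le> i" "i \<le> j" "j \<le> n" for i j
      using anti that by (auto simp: monotone_on_def)
    have p: "p = 3" using le[of 3 p] rest[of 3] pq by force
    have q: "q = 4" using le[of 4 q] rest[of 4] pq p by force
    have "\<sigma> = (\<Sum>i\<in>{3, 4}. (\<omega> i)\<^sup>2)"
      unfolding \<sigma>_def by (rule sum.mono_neutral_right) (use pq p q rest in auto)
    then have "(\<omega> 3)\<^sup>2 = s\<^sup>2" using \<sigma> pq p q by simp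
    then have "\<omega> 3 = s" using pq p rs(2) by (simp add: power2_eq_iff)
    moreover have "\<omega> i = 0" if "i \<ge> 5" for i
      using rest[of i] supp[of i] that p q by (cases "i \<le> n") auto
    ultimately show ?thesis using pq p q by simp
  qed
  show "\<omega> = omega_tau \<tau>"
  proof (intro ext)
    fix i :: nat
    consider "i = 0" | "i = 1" | "i = 2" | "i = 3" | "i = 4" | "i \<ge> 5" by linarith
    then show "\<omega> i = omega_tau \<tau> i"
      unfolding omega_tau_def r_def[symmetric] s_def[symmetric]
      by cases (use \<omega>12 tail_values supp[of 0] in auto)
  qed
qed

text \<open>
  Since \<open>s \<le> r\<close>, the tail \<open>s * \<epsilon>\<^sub>3 + s * \<epsilon>\<^sub>4\<close> never exceeds the offset \<open>2 * r\<close> in modulus, so Jensen's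
  inequality is an equality; the other half is the extremal case of Khintchine's inequality.
\<close>

lemma omega_tau_extremal:
  assumes n: "4 \<le> n" and \<tau>: "0 \<le> \<tau>" "\<tau> \<le> sqrt (2 - sqrt 2)"
  shows "omega_tau \<tau> \<in> C n \<tau>"
    and "mean_abs {1..n} (omega_tau \<tau>) 0
           = 1 / sqrt 2 + (sqrt (1 - \<tau>\<^sup>2 / 4) - \<tau>) * (\<tau> / (2 * sqrt 2))"
proof -
  let ?\<omega> = "omega_tau \<tau>"
  define r where "r = (1 - \<tau>\<^sup>2 / 2) / sqrt 2"
  define s where "s = \<tau> / sqrt 2 * sqrt (1 - \<tau>\<^sup>2 / 4)"
  have "\<tau>\<^sup>2 \<le> (sqrt (2 - sqrt 2))\<^sup>2" using \<tau>(2,1) by (rule power_mono)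
  moreover have "sqrt 2 \<le> (2::real)" by (rule real_le_lsqrt) simp_all
  ultimately have "\<tau>\<^sup>2 \<le> 2 - sqrt 2" by simp
  then have "\<tau>\<^sup>2 \<le> 2" using real_sqrt_ge_zero[of 2] by linarith
  note rs = omega_tau_norms[OF \<tau>(1) this, folded r_def s_def]
  have sr: "s \<le> r" using rs(6) \<tau>(2) .
  have entries: "?\<omega> i = (if i \<in> {1, 2} then r else if i \<in> {3, 4} then s else 0)" for i
    by (simp add: omega_tau_def r_def s_def)
  have "(\<Sum>i=3..n. (?\<omega> i)\<^sup>2) = (\<Sum>i\<in>{3, 4}. (?\<omega> i)\<^sup>2)"
    by (rule sum.mono_neutral_right) (use n in \<open>auto simp: entries\<close>)
  then have "(?\<omega> 1)\<^sup>2 + (?\<omega> 2)\<^sup>2 + (\<Sum>i=3..n. (?\<omega> i)\<^sup>2) = 1"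
    using rs(3) by (simp add: entries)
  moreover have "sqrt 2 * (?\<omega> 1 + ?\<omega> 2) = 2 - \<tau>\<^sup>2" using rs(4) by (simp add: entries)
  moreover have "antimono_on {1..n} ?\<omega>"
    using rs(1,2) sr by (auto simp: monotone_on_def entries)
  moreover have "?\<omega> \<in> real_space n" using n by (auto simp: real_space_def entries)
  ultimately show "?\<omega> \<in> C n \<tau>"
    using n \<tau>(1) rs(1,2) by (subst C_iff) (auto simp: entries)
  have tail: "mean_abs {3..n} ?\<omega> c = (\<bar>c + 2 * s\<bar> + 2 * \<bar>c\<bar> + \<bar>c - 2 * s\<bar>) / 4" for c
  proof -
    have "mean_abs {3..n} ?\<omega> c = mean_abs {3, 4} ?\<omega> c"
      by (rule mean_abs_zeros) (use n in \<open>auto simp: entries\<close>)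
    also have "\<dots> = (mean_abs {4} ?\<omega> (c + s) + mean_abs {4} ?\<omega> (c - s)) / 2"
      by (simp add: mean_abs_insert[of "{4}" 3] entries)
    also have "mean_abs {4} ?\<omega> (c + s) = (\<bar>c + 2 * s\<bar> + \<bar>c\<bar>) / 2"
      by (simp add: mean_abs_insert entries algebra_simps)
    also have "mean_abs {4} ?\<omega> (c - s) = (\<bar>c\<bar> + \<bar>c - 2 * s\<bar>) / 2"
      by (simp add: mean_abs_insert entries algebra_simps)
    finally show ?thesis by (simp add: field_simps)
  qed
  have "mean_abs {1..n} ?\<omega> 0 = (mean_abs {3..n} ?\<omega> (2 * r) + mean_abs {3..n} ?\<omega> 0) / 2"
    using mean_abs_split_first_two[of n ?\<omega>] n by (simp add: entries)
  also have "\<dots> = r + s / 2" unfolding tail using sr rs(1,2) by simp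
  finally show "mean_abs {1..n} ?\<omega> 0
      = 1 / sqrt 2 + (sqrt (1 - \<tau>\<^sup>2 / 4) - \<tau>) * (\<tau> / (2 * sqrt 2))"
    unfolding rs(5) .
qed

theorem theorem1:
  fixes M :: "'a measure" and \<epsilon> :: "nat \<Rightarrow> 'a \<Rightarrow> real" and n :: nat and \<tau> :: real
  assumes "prob_space M"
    and "prob_space.indep_vars M (\<lambda>_. borel) \<epsilon> {1..n}"
    and "\<And>i. i \<in> {1..n} \<Longrightarrow> rademacher M (\<epsilon> i)"
    and "n \<ge> 2" and "\<tau> \<ge> 0"
  shows "(C n \<tau> \<noteq> {} \<longrightarrow>
            (\<forall>\<omega>\<in>C n \<tau>. K M \<epsilon> n \<omega> \<ge>
               1 / sqrt 2 + (sqrt (1 - \<tau>\<^sup>2 / 4) - \<tau>) * (\<tau> / (2 * sqrt 2)))) \<and>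
         (n \<ge> 4 \<and> \<tau> \<le> sqrt (2 - sqrt 2) \<longrightarrow>
            (\<exists>\<omega>\<in>C n \<tau>. K M \<epsilon> n \<omega> =
               1 / sqrt 2 + (sqrt (1 - \<tau>\<^sup>2 / 4) - \<tau>) * (\<tau> / (2 * sqrt 2))) \<and>
            (\<forall>\<omega>\<in>C n \<tau>. K M \<epsilon> n \<omega> =
               1 / sqrt 2 + (sqrt (1 - \<tau>\<^sup>2 / 4) - \<tau>) * (\<tau> / (2 * sqrt 2))
               \<longleftrightarrow> \<omega> = omega_tau \<tau>))"
proof -
  interpret prob_space M by (rule assms(1))
  have K: "K M \<epsilon> n \<omega> = mean_abs {1..n} \<omega> 0" for \<omega>
    using expectation_abs_rademacher_sum[of "{1..n}" \<epsilon> 0 \<omega>] assms(2,3) by (simp add: K_def)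
  note bound = extremal_bound[OF assms(4,5)]
  show ?thesis
    unfolding K using bound omega_tau_extremal[of n \<tau>] assms(5) by blast
qed

end
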